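(* Let $X$ be a compact metric space and let $f:X\to X$ be a homeomorphism satisfying property (CW). Then $X^{slc}\subset A(f)$, i.e. every point at which $X$ is semi-locally connected is an almost automorphic point of $f$.
   Context: Let $(X,d)$ be a compact metric space and $f:X\to X$ a homeomorphism; $f^n$ denotes the $n$-th iterate for $n\in\mathbb{Z}$. For $p\in X$ and nonempty $B\subset X$, $dist(p,B)=\inf\{d(p,b):b\in B\}$. A subcontinuum of $X$ is a nonempty compact connected subset of $X$. $f$ satisfies property (CW) if $\inf_{n\in\mathbb{Z}}dist(f^n(x),f^n(C))>0$ for every $x\in X$ and every subcontinuum $C$ of $X$ with $x\notin C$. $X$ is semi-locally connected at $p\in X$ if for every open neighborhood $U$ of $p$ there is an open neighborhood $V\subset U$ of $p$ such that $X\setminus U$ is contained in the union of finitely many connected components of $X\setminus V$. $X^{slc}$ denotes the set of points at which $X$ is semi-locally connected. A point $x\in X$ is almost automorphic (for $f$) if for every sequence $n_i\in\mathbb{Z}$ with $f^{n_i}(x)\to y$ for some $y\in X$ it holds that $f^{-n_i}(y)\to x$. $A(f)$ denotes the set of almost automorphic points of $f$. *)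

theory Defs
  imports "HOL-Analysis.Analysis"
begin

text \<open>Spaces are carrier sets \<open>X\<close> in a metric space type, with the induced metric and the
  subspace topology \<open>top_of_set X\<close>. Maps \<open>f\<close> are only meaningful on \<open>X\<close>.\<close>

definition self_homeomorphism :: "'a::topological_space set \<Rightarrow> ('a \<Rightarrow> 'a) \<Rightarrow> bool" where
  "self_homeomorphism X f \<longleftrightarrow> (\<exists>g. homeomorphism X X f g)"

text \<open>For negative \<open>n\<close> the inverse is taken relative to \<open>X\<close>, since \<open>f\<close> need not be injective
  outside \<open>X\<close>; the value is only meaningful at points of \<open>X\<close>.\<close>

definition iterate :: "'a set \<Rightarrow> ('a \<Rightarrow> 'a) \<Rightarrow> int \<Rightarrow> 'a \<Rightarrow> 'a" where
  "iterate X f n = (if n \<ge> 0 then f ^^ nat n else (inv_into X f) ^^ nat (- n))"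

definition subcontinuum :: "'a::topological_space set \<Rightarrow> 'a set \<Rightarrow> bool" where
  "subcontinuum X C \<longleftrightarrow> C \<subseteq> X \<and> C \<noteq> {} \<and> compact C \<and> connected C"

text \<open>The infimum over \<open>n\<close> is a genuine one: the values are nonnegative, hence bounded below.\<close>

definition property_CW :: "'a::metric_space set \<Rightarrow> ('a \<Rightarrow> 'a) \<Rightarrow> bool" where
  "property_CW X f \<longleftrightarrow>
     (\<forall>x\<in>X. \<forall>C. subcontinuum X C \<and> x \<notin> C \<longrightarrow>
        (INF n::int. infdist (iterate X f n x) (iterate X f n ` C)) > 0)"

definition semi_locally_connected_at :: "'a::topological_space set \<Rightarrow> 'a \<Rightarrow> bool" where
  "semi_locally_connected_at X p \<longleftrightarrow>
     (\<forall>U. openin (top_of_set X) U \<and> p \<in> U \<longrightarrow>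
        (\<exists>V. openin (top_of_set X) V \<and> p \<in> V \<and> V \<subseteq> U \<and>
           (\<exists>F. finite F \<and> F \<subseteq> components (X - V) \<and> X - U \<subseteq> \<Union>F)))"

definition slc_points :: "'a::topological_space set \<Rightarrow> 'a set" where
  "slc_points X = {p \<in> X. semi_locally_connected_at X p}"

definition almost_automorphic :: "'a::topological_space set \<Rightarrow> ('a \<Rightarrow> 'a) \<Rightarrow> 'a \<Rightarrow> bool" where
  "almost_automorphic X f x \<longleftrightarrow>
     (\<forall>(n :: nat \<Rightarrow> int) y. y \<in> X \<and> (\<lambda>i. iterate X f (n i) x) \<longlonglongrightarrow> y \<longrightarrow>
        (\<lambda>i. iterate X f (- n i) y) \<longlonglongrightarrow> x)"

definition almost_automorphic_points :: "'a::topological_space set \<Rightarrow> ('a \<Rightarrow> 'a) \<Rightarrow> 'a set" where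
  "almost_automorphic_points X f = {x \<in> X. almost_automorphic X f x}"

end

theory Submission
  imports Defs
begin

text \<open>Semi-local connectedness at \<open>p\<close> covers the complement of a neighbourhood \<open>U\<close> of \<open>p\<close> by
  finitely many subcontinua avoiding \<open>p\<close>, so (CW) yields \<open>\<delta> > 0\<close> such that no iterate brings
  \<open>p\<close> within \<open>\<delta>\<close> of a point outside \<open>U\<close>. If \<open>f\<^sup>n(p)\<close> is \<open>\<delta>\<close>-close to \<open>y\<close>, then applying this to
  the point \<open>f\<^sup>-\<^sup>n(y)\<close>, which \<open>f\<^sup>n\<close> sends to \<open>y\<close>, shows that it lies in \<open>U\<close>.\<close>

lemma bij_betw_iterate:
  assumes "bij_betw f X X"
  shows "bij_betw (iterate X f n) X X"
  using assms bij_betw_funpow[OF assms] bij_betw_funpow[OF bij_betw_inv_into[OF assms]]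
  by (simp add: iterate_def)

text \<open>Stated for any right inverse \<open>g\<close> of \<open>f\<close> on \<open>X\<close>,
  so that it covers both signs of the exponent by exchanging \<open>f\<close> and
  \<open>inv_into X f\<close>.\<close>

lemma funpow_inverse_on:
  assumes "\<And>x. x \<in> X \<Longrightarrow> g x \<in> X" and "\<And>x. x \<in> X \<Longrightarrow> f (g x) = x" and "y \<in> X"
  shows "(f ^^ k) ((g ^^ k) y) = y"
  using \<open>y \<in> X\<close>
proof (induction k arbitrary: y)
  case (Suc k)
  have "(g ^^ k) y \<in> X"
    using Suc.prems assms(1) by (induction k) auto
  \<comment> \<open>The innermost \<open>f\<close> is moved next to the outermost \<open>g\<close>,
    where the two cancel at a point of \<open>X\<close>.\<close>
  moreover have "(f ^^ Suc k) ((g ^^ Suc k) y) = (f ^^ k) (f (g ((g ^^ k) y)))"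
    by (simp add: funpow_swap1)
  ultimately show ?case
    using Suc assms(2) by simp
qed simp

lemma iterate_iterate_uminus:
  assumes f: "bij_betw f X X" and y: "y \<in> X"
  shows "iterate X f n (iterate X f (- n) y) = y"
proof -
  note inv = bij_betw_inv_into[OF f]
  have "(f ^^ k) ((inv_into X f ^^ k) y) = y" for k
    using funpow_inverse_on[of X "inv_into X f" f] bij_betwE[OF inv] bij_betw_inv_into_right[OF f] y
    by blast
  moreover have "(inv_into X f ^^ k) ((f ^^ k) y) = y" for k
    using funpow_inverse_on[of X f "inv_into X f"] bij_betwE[OF f] bij_betw_inv_into_left[OF f] y
    by blast
  ultimately show ?thesis
    by (auto simp: iterate_def)
qed

text \<open>The infimum in (CW) itself serves as \<open>e\<close>: it bounds each
  \<open>infdist\<close> from below, hence each single distance.\<close>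

lemma property_CW_separation:
  assumes "property_CW X f" "p \<in> X" "subcontinuum X C" "p \<notin> C"
  obtains e where "e > 0" "\<And>n z. z \<in> C \<Longrightarrow> e \<le> dist (iterate X f n p) (iterate X f n z)"
proof -
  let ?d = "\<lambda>n. infdist (iterate X f n p) (iterate X f n ` C)"
  have "(INF n. ?d n) > 0"
    using assms unfolding property_CW_def by blast
  moreover have "(INF n. ?d n) \<le> dist (iterate X f n p) (iterate X f n z)" if "z \<in> C" for n z
  proof -
    have "bdd_below (range ?d)"
      by (intro bdd_belowI[of _ 0]) (auto simp: infdist_nonneg)
    then have "(INF n. ?d n) \<le> ?d n"
      by (intro cINF_lower) auto
    also have "\<dots> \<le> dist (iterate X f n p) (iterate X f n z)"
      using that by (intro infdist_le) simp
    finally show ?thesis .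
  qed
  ultimately show thesis
    using that by blast
qed

lemma slc_separation:
  assumes "compact X" "property_CW X f" "p \<in> X" "semi_locally_connected_at X p"
    and U: "openin (top_of_set X) U" "p \<in> U"
  obtains e where "e > 0" "\<And>n z. z \<in> X - U \<Longrightarrow> e \<le> dist (iterate X f n p) (iterate X f n z)"
proof -
  obtain V F where V: "openin (top_of_set X) V" "p \<in> V" "finite F" "F \<subseteq> components (X - V)"
    "X - U \<subseteq> \<Union>F"
    using assms(4) U unfolding semi_locally_connected_at_def by metis
  obtain T where "open T" "V = X \<inter> T"
    using V(1) by (auto simp: openin_open)
  \<comment> \<open>Components of the compact set \<open>X - V\<close> are closed in it, hence
    compact; they miss \<open>p\<close> because \<open>p\<close> lies in \<open>V\<close>.\<close>
  then have "X - V = X - T" "compact (X - T)"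
    using \<open>compact X\<close> by (auto intro: compact_diff)
  then have sub: "subcontinuum X C \<and> p \<notin> C" if "C \<in> F" for C
    using that V closedin_compact[OF _ closedin_component, of "X - V" C] in_components_subset[of C "X - V"]
      in_components_connected[of C "X - V"] in_components_nonempty[of C "X - V"]
    unfolding subcontinuum_def by auto
  have "\<exists>e>0. \<forall>n. \<forall>z\<in>C. e \<le> dist (iterate X f n p) (iterate X f n z)" if "C \<in> F" for C
    using property_CW_separation[OF assms(2,3), of C] sub[OF that] by metis
  then obtain e where e: "\<And>C. C \<in> F \<Longrightarrow> e C > 0"
    "\<And>C n z. C \<in> F \<Longrightarrow> z \<in> C \<Longrightarrow> e C \<le> dist (iterate X f n p) (iterate X f n z)"
    by metis
  show thesis
  proof
    \<comment> \<open>The inserted 1 keeps the minimum meaningful when \<open>F\<close> is empty,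
      which can happen if \<open>U = X\<close>.\<close>
    show "Min (insert 1 (e ` F)) > (0::real)"
      using e(1) V(3) by simp
    fix n z assume "z \<in> X - U"
    then obtain C where "C \<in> F" "z \<in> C"
      using V(5) by blast
    then have "Min (insert 1 (e ` F)) \<le> e C"
      using V(3) by (intro Min_le) auto
    also have "\<dots> \<le> dist (iterate X f n p) (iterate X f n z)"
      using e(2) \<open>C \<in> F\<close> \<open>z \<in> C\<close> by blast
    finally show "Min (insert 1 (e ` F)) \<le> dist (iterate X f n p) (iterate X f n z)" .
  qed
qed

theorem theorem1p6:
  fixes X :: "'a::metric_space set" and f :: "'a \<Rightarrow> 'a"
  assumes "compact X"
    and "self_homeomorphism X f"
    and "property_CW X f"
  shows "slc_points X \<subseteq> almost_automorphic_points X f"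
proof
  fix p assume "p \<in> slc_points X"
  then have p: "p \<in> X" "semi_locally_connected_at X p"
    by (auto simp: slc_points_def)
  have f: "bij_betw f X X"
    using assms(2) unfolding self_homeomorphism_def homeomorphism_def
    by (metis bij_betw_byWitness order_refl)
  have "(\<lambda>i. iterate X f (- n i) y) \<longlonglongrightarrow> p"
    if y: "y \<in> X" "(\<lambda>i. iterate X f (n i) p) \<longlonglongrightarrow> y" for n :: "nat \<Rightarrow> int" and y
  proof (rule topological_tendstoI)
    fix S assume S: "open S" "p \<in> S"
    obtain e where e: "e > 0"
      "\<And>n z. z \<in> X - X \<inter> S \<Longrightarrow> e \<le> dist (iterate X f n p) (iterate X f n z)"
      using slc_separation[OF assms(1,3) p, of "X \<inter> S"] S p(1) openin_open_Int by blast
    have "\<forall>\<^sub>F i in sequentially. dist (iterate X f (n i) p) y < e"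
      using y(2) e(1) by (rule tendstoD)
    then show "\<forall>\<^sub>F i in sequentially. iterate X f (- n i) y \<in> S"
    proof (rule eventually_mono)
      fix i assume "dist (iterate X f (n i) p) y < e"
      then show "iterate X f (- n i) y \<in> S"
        \<comment> \<open>The point fed into the bound varies with \<open>i\<close>, so
          \<open>e\<close> has to be uniform in \<open>z\<close> as well as in \<open>n\<close>. If
          this point were outside \<open>S\<close>, the bound would give
          \<open>e \<le> dist (iterate X f (n i) p) y\<close>.\<close>
        using e(2)[of "iterate X f (- n i) y" "n i"] iterate_iterate_uminus[OF f y(1), of "n i"]
          bij_betwE[OF bij_betw_iterate[OF f, of "- n i"]] y(1)
        by fastforce
    qed
  qed
  then show "p \<in> almost_automorphic_points X f"
    using p(1) by (auto simp: almost_automorphic_points_def almost_automorphic_def)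
qed

end
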